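(* Let $P\subset\mathbb{R}^N$ be a rational polytope with denominator $d$, and let $\mathring{P}$ denote its relative interior. Then the counting functions $L(P,t)=\#(tP\cap\mathbb{Z}^N)$ ($t\ge 0$) and $L(\mathring{P},t)=\#(t\mathring{P}\cap\mathbb{Z}^N)$ ($t>0$) have the quasi-polynomial pattern \[ L(P,t)=\sum_{k=0}^{\dim P} c_k(P, t)\, t^k,\quad t\ge 0, \qquad L(\mathring{P},t)=\sum_{k=0}^{\dim P} c_k(\mathring{P}, t)\,t^k,\quad t>0, \] where $c_k(P, t)$ for $t\ge 0$ and $c_k(\mathring{P}, t)$ for $t>0$ are periodic functions of period $d$. Moreover, $L(P,t)$ and $L(\mathring{P},t)$ extend, via these same two expansions $\sum_{k=0}^{\dim P} c_k(P,t)t^k$ and $\sum_{k=0}^{\dim P} c_k(\mathring{P},t)t^k$, to real quasi-polynomials of the real variable $t$ as follows: \begin{itemize} \item for $t<0$, set $c_k(P,t):=c_k(P,t+md)$ with any integer $m$ such that $t+md\ge 0$; \item for $t\le 0$, set $c_k(\mathring{P},t):=c_k(\mathring{P},t+md)$ with any integer $m$ such that $t+md>0$. \end{itemize}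
   Context: A real quasi-polynomial of degree $m$ is a function $f:\mathbb{R}\to\mathbb{C}$ of the form $f(t)=\sum_{k=0}^m c_k(t)t^k$ with each $c_k:\mathbb{R}\to\mathbb{C}$ periodic (convention $t^0\equiv 1$). A polytope is rational if all its vertices have rational coordinates. The denominator $d$ of a rational polytope $P$ is the smallest positive real number such that $dP$ is an integral polytope (i.e. has integer vertices); equivalently $d=\mathrm{lcm}(P)/\gcd(P)$, where $\gcd(P)$ (resp. $\mathrm{lcm}(P)$) is the greatest common divisor of the numerators (resp. least common multiple of the denominators) of the vertex coordinates in reduced form. For $t\ge0$, $tP=\{tx:x\in P\}$, and $\mathring{P}=P\setminus\partial P$ is the relative interior of $P$ in its affine span. *)

theory Defs
  imports "HOL-Analysis.Analysis"
begin

definition int_lattice :: "(real ^ 'n) set" where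
  "int_lattice = {x. \<forall>i. x $ i \<in> \<int>}"

definition rational_polytope :: "(real ^ 'n) set \<Rightarrow> bool" where
  "rational_polytope P \<longleftrightarrow> polytope P \<and> (\<forall>v. v extreme_point_of P \<longrightarrow> (\<forall>i. v $ i \<in> \<rat>))"

definition integral_polytope :: "(real ^ 'n) set \<Rightarrow> bool" where
  "integral_polytope P \<longleftrightarrow> polytope P \<and> (\<forall>v. v extreme_point_of P \<longrightarrow> v \<in> int_lattice)"

definition dilate :: "real \<Rightarrow> (real ^ 'n) set \<Rightarrow> (real ^ 'n) set" where
  "dilate t X = (\<lambda>x. t *\<^sub>R x) ` X"

text \<open>The denominator is the smallest positive \<^emph>\<open>real\<close> dilation factor giving an integral
  polytope; it need not be an integer. It is a relation because no smallest such factor exists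
  for the empty polytope and for the polytope whose only point is the origin.\<close>

definition is_denominator :: "(real ^ 'n) set \<Rightarrow> real \<Rightarrow> bool" where
  "is_denominator P d \<longleftrightarrow>
     d > 0 \<and> integral_polytope (dilate d P) \<and>
     (\<forall>s>0. integral_polytope (dilate s P) \<longrightarrow> d \<le> s)"

definition lattice_count :: "(real ^ 'n) set \<Rightarrow> real \<Rightarrow> nat" where
  "lattice_count X t = card (dilate t X \<inter> int_lattice)"

text \<open>The library's \<^term>\<open>aff_dim\<close> is an integer, equal to \<open>-1\<close> only for the empty set.\<close>

definition poly_dim :: "(real ^ 'n) set \<Rightarrow> nat" where
  "poly_dim P = nat (aff_dim P)"

definition expansion :: "nat \<Rightarrow> (nat \<Rightarrow> real \<Rightarrow> complex) \<Rightarrow> real \<Rightarrow> complex" where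
  "expansion m c t = (\<Sum>k\<le>m. c k t * complex_of_real t ^ k)"

definition periodic :: "(real \<Rightarrow> complex) \<Rightarrow> bool" where
  "periodic g \<longleftrightarrow> (\<exists>T>0. \<forall>t. g (t + T) = g t)"

definition real_quasi_polynomial :: "nat \<Rightarrow> (real \<Rightarrow> complex) \<Rightarrow> bool" where
  "real_quasi_polynomial m f \<longleftrightarrow>
     (\<exists>c. (\<forall>k\<le>m. periodic (c k)) \<and> (\<forall>t. f t = expansion m c t))"

text \<open>\<open>extends_from S d g e\<close>: the function \<open>e\<close> on the whole line agrees with \<open>g\<close> on \<open>S\<close>
  and is given at every other point \<open>t\<close> by the value of \<open>g\<close> at \<open>t + m d\<close>, for \<^emph>\<open>any\<close> integer
  \<open>m\<close> with \<open>t + m d\<close> in \<open>S\<close>. In particular that value does not depend on \<open>m\<close>.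
  Values of \<open>g\<close> outside \<open>S\<close> are irrelevant.\<close>

definition extends_from ::
    "real set \<Rightarrow> real \<Rightarrow> (real \<Rightarrow> complex) \<Rightarrow> (real \<Rightarrow> complex) \<Rightarrow> bool" where
  "extends_from S d g e \<longleftrightarrow>
     (\<forall>t\<in>S. e t = g t) \<and>
     (\<forall>t. t \<notin> S \<longrightarrow> (\<forall>m::int. t + of_int m * d \<in> S \<longrightarrow> e t = g (t + of_int m * d)))"

end

theory Submission
  imports Defs "HOL-Computational_Algebra.Polynomial"
begin

text \<open>Put the integral polytope \<open>Q = dP\<close> at height \<open>1\<close>; the lattice points of \<open>sQ\<close> are the points
  \<open>(s, x)\<close> with \<open>x\<close> integral of the cone over \<open>Q\<close>. Adding the vertices one at a time partitions this
  cone into half-open simplicial cones on linearly independent vertices. In such a cone with \<open>k\<close>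
  generators, each integral of height \<open>1\<close>, subtracting generators reduces every point to a half-open
  parallelepiped, so the count at height \<open>s\<close> is a \<open>k\<close>-fold antidifference of a function of bounded
  support: a quasi-polynomial of period \<open>1\<close> and degree below \<open>k\<close>. Since the parallelepiped has height
  at most \<open>k\<close> and each antidifference extends the range of validity downwards by \<open>1\<close>, the formula
  holds from \<open>s = 0\<close> on. The relative interior is a union of open simplicial cones of the partition.\<close>

section \<open>Quasi-polynomials of period 1\<close>

text \<open>All coefficients at \<open>s\<close> are bundled into one polynomial \<open>p s\<close>,
  so that antidifferences can be taken of whole polynomials. The bound \<open>k\<close> is strict:
  \<open>k = 0\<close> makes \<open>G\<close> vanish on \<open>D\<close>. The period of
  \<open>p\<close> is required on the whole line although \<open>G\<close> is prescribed only on
  \<open>D\<close>; this later gives the extension to all real arguments.\<close>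

definition quasi_poly_on :: "nat \<Rightarrow> real set \<Rightarrow> (real \<Rightarrow> real) \<Rightarrow> bool" where
  "quasi_poly_on k D G \<longleftrightarrow>
     (\<exists>p :: real \<Rightarrow> real poly. (\<forall>s. p (s + 1) = p s) \<and> (\<forall>s. \<forall>i\<ge>k. coeff (p s) i = 0) \<and>
        (\<forall>s\<in>D. G s = poly (p s) s))"

lemma quasi_poly_on_zero: "(\<And>s. s \<in> D \<Longrightarrow> G s = 0) \<Longrightarrow> quasi_poly_on k D G"
  unfolding quasi_poly_on_def by (rule exI[of _ "\<lambda>_. 0"]) simp

lemma quasi_poly_on_mono:
  assumes "quasi_poly_on k D G" "k \<le> k'" "\<And>s. s \<in> D' \<Longrightarrow> s \<in> D \<and> G' s = G s"
  shows "quasi_poly_on k' D' G'"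
proof -
  from assms(1) obtain p :: "real \<Rightarrow> real poly" where
    "\<forall>s. p (s + 1) = p s" "\<forall>s. \<forall>i\<ge>k. coeff (p s) i = 0" "\<forall>s\<in>D. G s = poly (p s) s"
    unfolding quasi_poly_on_def by blast
  then show ?thesis
    unfolding quasi_poly_on_def using assms(2,3) by (intro exI[of _ p]) auto
qed

lemma quasi_poly_on_sum:
  assumes "\<And>x. x \<in> A \<Longrightarrow> quasi_poly_on k D (G x)"
  shows "quasi_poly_on k D (\<lambda>s. \<Sum>x\<in>A. G x s)"
proof -
  from assms have "\<exists>p. \<forall>x\<in>A. (\<forall>s. p x (s + 1) = p x s) \<and> (\<forall>s. \<forall>i\<ge>k. coeff (p x s) i = 0) \<and>
        (\<forall>s\<in>D. G x s = poly (p x s) s)"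
    unfolding quasi_poly_on_def by (intro bchoice) blast
  then obtain p :: "'a \<Rightarrow> real \<Rightarrow> real poly" where p: "\<forall>x\<in>A. (\<forall>s. p x (s + 1) = p x s) \<and>
      (\<forall>s. \<forall>i\<ge>k. coeff (p x s) i = 0) \<and> (\<forall>s\<in>D. G x s = poly (p x s) s)" ..
  then show ?thesis
    unfolding quasi_poly_on_def
    by (intro exI[of _ "\<lambda>s. \<Sum>x\<in>A. p x s"]) (auto simp: coeff_sum poly_sum)
qed

text \<open>Induction on the degree bound: the backward difference of a multiple of x^(k+1) has the
  same term of degree k as \<open>p\<close>, and subtracting it lowers the degree.\<close>

lemma poly_antidifference_exists:
  fixes p :: "real poly"
  assumes "\<And>i. i \<ge> k \<Longrightarrow> coeff p i = 0"
  shows "\<exists>q. (\<forall>i\<ge>Suc k. coeff q i = 0) \<and> (\<forall>x. poly q x - poly q (x - 1) = poly p x)"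
  using assms
proof (induction k arbitrary: p)
  case 0
  then have "p = 0" by (intro poly_eqI) simp
  then show ?case by (intro exI[of _ 0]) simp
next
  case (Suc k)
  \<comment> \<open>\<open>l\<close> is the polynomial m(x - 1). The divisor k + 1 cancels the
    leading coefficient of x^(k+1) - (x - 1)^(k+1).\<close>
  define m where "m = monom (coeff p k / (real k + 1)) (Suc k)"
  define l :: "real poly" where "l = smult (coeff p k / (real k + 1)) ([:-1, 1:] ^ Suc k)"
  have l: "coeff l i = coeff p k / (real k + 1) * (real (Suc k choose i) * (-1) ^ (Suc k - i))"
    if "i \<le> Suc k" for i
    using that unfolding l_def by (simp only: coeff_smult coeff_linear_poly_power) simp
  have l': "coeff l i = 0" if "i > Suc k" for i
  proof -
    have "degree l \<le> Suc k" unfolding l_def by (simp add: degree_linear_power del: power_Suc)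
    with that show ?thesis by (intro coeff_eq_0) simp
  qed
  have 0: "coeff (p - (m - l)) i = 0" if ik: "i \<ge> k" for i
  proof -
    consider "i = k" | "i = Suc k" | "i > Suc k" using ik by linarith
    then show ?thesis
    proof cases
      case 1
      have "real k + 1 \<noteq> 0" by linarith
      with 1 show ?thesis by (simp add: m_def l divide_simps) (simp add: algebra_simps)
    next
      case 2 then show ?thesis using Suc.prems by (simp add: m_def l)
    next
      case 3 then show ?thesis using Suc.prems l' by (simp add: m_def)
    qed
  qed
  from Suc.IH[OF 0] obtain q where
    q: "\<forall>i\<ge>Suc k. coeff q i = 0" "\<forall>x. poly q x - poly q (x - 1) = poly (p - (m - l)) x"
    by blast
  have "poly m (x - 1) = poly l x" for x
    by (simp add: m_def l_def poly_monom algebra_simps)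
  with q show ?case
    by (intro exI[of _ "q + m"]) (auto simp: m_def algebra_simps)
qed

text \<open>Antidifferences of the \<open>p s\<close> solve the same difference equation as
  \<open>G\<close>, so \<open>G\<close> differs from them by a function of period 1, which goes into
  the constant term. The equation at \<open>s\<close> also involves \<open>s - 1\<close>; hence the
  domain grows downwards by 1.\<close>

lemma quasi_poly_on_antidifference:
  assumes G': "quasi_poly_on k D G'" and diff: "\<And>s. s \<in> D \<Longrightarrow> G s - G (s - 1) = G' s"
    and up: "\<And>s. s \<in> D \<Longrightarrow> s + 1 \<in> D"
  shows "quasi_poly_on (Suc k) {s. s + 1 \<in> D} G"
proof -
  from G' obtain p :: "real \<Rightarrow> real poly" where p: "\<And>s. p (s + 1) = p s"
    "\<And>s i. i \<ge> k \<Longrightarrow> coeff (p s) i = 0" "\<And>s. s \<in> D \<Longrightarrow> G' s = poly (p s) s"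
    unfolding quasi_poly_on_def by blast
  \<comment> \<open>The choice is made per polynomial and not per \<open>s\<close>, so that
    \<open>ad (p s)\<close> inherits the period of \<open>p\<close>.\<close>
  define ad where "ad u = (SOME q. (\<forall>i\<ge>Suc k. coeff q i = 0) \<and>
      (\<forall>x. poly q x - poly q (x - 1) = poly u x))" for u :: "real poly"
  have ad: "(\<forall>i\<ge>Suc k. coeff (ad (p s)) i = 0) \<and>
      (\<forall>x. poly (ad (p s)) x - poly (ad (p s)) (x - 1) = poly (p s) x)" for s
    unfolding ad_def by (rule someI_ex[OF poly_antidifference_exists]) (rule p(2))
  define h where "h s = G s - poly (ad (p s)) s" for s
  have hstep: "h (s + 1) = h s" if "s + 1 \<in> D" for s
  proof -
    have "poly (ad (p s)) (s + 1) - poly (ad (p s)) (s + 1 - 1) = poly (p s) (s + 1)"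
      using ad[of s] by blast
    then show ?thesis
      using diff[OF that] p(3)[OF that] p(1)[of s] unfolding h_def by simp
  qed
  have hnat: "h (s + real n) = h s" if "s + 1 \<in> D" for s n
  proof (induction n)
    case (Suc n)
    have "s + real n + 1 \<in> D"
    proof (induction n)
      case (Suc n)
      from up[OF Suc.IH] show ?case by (simp add: algebra_simps)
    qed (use that in simp)
    from hstep[OF this] Suc.IH show ?case by (simp add: algebra_simps)
  qed simp
  have hint: "h (s + of_int m) = h (s + of_int m')"
    if "s + of_int m + 1 \<in> D" "s + of_int m' + 1 \<in> D" for s and m m' :: int
  proof (cases "m \<le> m'")
    case True
    then obtain n where "m' = m + int n" using zle_iff_zadd by blast
    then show ?thesis using hnat[OF that(1), of n] by (simp add: algebra_simps)
  next
    case False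
    then obtain n where "m = m' + int n" using zle_iff_zadd by (metis linear)
    then show ?thesis using hnat[OF that(2), of n] by (simp add: algebra_simps)
  qed
  \<comment> \<open>\<open>h\<close> is known to be periodic only where the difference equation is
    available. \<open>C s\<close> is its value at some integer translate of \<open>s\<close> in that
    range: by \<open>hint\<close> any translate will do, and the choice depends only on
    \<open>s\<close> modulo 1, so \<open>C\<close> has period 1 everywhere.\<close>
  define C where "C s = (SOME y. \<exists>m::int. s + of_int m + 1 \<in> D \<and> y = h (s + of_int m))" for s
  have C: "C s = h s" if "s + 1 \<in> D" for s
  proof -
    have "\<exists>m::int. s + of_int m + 1 \<in> D \<and> C s = h (s + of_int m)"
      unfolding C_def by (rule someI_ex) (use that in \<open>auto intro!: exI[of _ "0::int"]\<close>)
    then obtain m :: int where "s + of_int m + 1 \<in> D" "C s = h (s + of_int m)" by blast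
    with hint[of s m 0] that show ?thesis by simp
  qed
  have shift: "(\<exists>m::int. s + 1 + of_int m + 1 \<in> D \<and> y = h (s + 1 + of_int m)) \<longleftrightarrow>
      (\<exists>m::int. s + of_int m + 1 \<in> D \<and> y = h (s + of_int m))" for s y
  proof
    assume "\<exists>m::int. s + 1 + of_int m + 1 \<in> D \<and> y = h (s + 1 + of_int m)"
    then obtain m :: int where "s + 1 + of_int m + 1 \<in> D \<and> y = h (s + 1 + of_int m)" ..
    then show "\<exists>m::int. s + of_int m + 1 \<in> D \<and> y = h (s + of_int m)"
      by (intro exI[of _ "m + 1"]) (simp add: algebra_simps)
  next
    assume "\<exists>m::int. s + of_int m + 1 \<in> D \<and> y = h (s + of_int m)"
    then obtain m :: int where "s + of_int m + 1 \<in> D \<and> y = h (s + of_int m)" ..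
    then show "\<exists>m::int. s + 1 + of_int m + 1 \<in> D \<and> y = h (s + 1 + of_int m)"
      by (intro exI[of _ "m - 1"]) (simp add: algebra_simps)
  qed
  have Cper: "C (s + 1) = C s" for s
    unfolding C_def shift ..
  show ?thesis
    unfolding quasi_poly_on_def
  proof (intro exI[of _ "\<lambda>s. ad (p s) + [:C s:]"] conjI allI ballI impI)
    fix s i assume "Suc k \<le> i"
    then show "coeff (ad (p s) + [:C s:]) i = 0"
      using ad[of s] by (auto simp: coeff_pCons split: nat.split)
  next
    fix s assume "s \<in> {s. s + 1 \<in> D}"
    then show "G s = poly (ad (p s) + [:C s:]) s" using C[of s] by (simp add: h_def)
  qed (simp add: p(1) Cper)
qed

section \<open>Partitions of cones into open simplicial cones\<close>

text \<open>A separate coefficient set for each generator lets one definition cover open cones,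
  half-open cones and half-open parallelepipeds.\<close>

definition comb_set :: "'a::real_vector set \<Rightarrow> ('a \<Rightarrow> real set) \<Rightarrow> 'a set" where
  "comb_set S I = {x. \<exists>c. (\<forall>w\<in>S. c w \<in> I w) \<and> x = (\<Sum>w\<in>S. c w *\<^sub>R w)}"

abbreviation open_cone :: "'a::real_vector set \<Rightarrow> 'a set" where
  "open_cone S \<equiv> comb_set S (\<lambda>_. {0<..})"

abbreviation apex_cone :: "'a::real_vector \<Rightarrow> 'a set \<Rightarrow> 'a set" where
  "apex_cone a S \<equiv> comb_set (insert a S) (\<lambda>w. if w = a then {0..} else {0<..})"

lemma pos_perturb:
  fixes c u :: "'a \<Rightarrow> real"
  assumes "finite S" "\<And>w. w \<in> S \<Longrightarrow> 0 < c w"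
  shows "\<exists>e>0. \<forall>w\<in>S. 0 < c w - e * u w"
proof -
  have "\<forall>\<^sub>F e in at_right 0. 0 < c w - e * u w" if "w \<in> S" for w
  proof -
    have "((\<lambda>e. c w - e * u w) \<longlongrightarrow> c w - 0 * u w) (at_right 0)"
      by (intro tendsto_intros)
    then show ?thesis using assms(2)[OF that] by (intro order_tendstoD(1)) auto
  qed
  then have "\<forall>\<^sub>F e in at_right 0. \<forall>w\<in>S. 0 < c w - e * u w"
    using assms(1) by (simp add: eventually_ball_finite_distrib)
  then have "\<forall>\<^sub>F e in at_right 0. (\<forall>w\<in>S. 0 < c w - e * u w) \<and> (0::real) < e"
    by (intro eventually_conj eventually_at_right_less)
  from eventually_happens[OF this] show ?thesis by auto
qed

text \<open>An open cone is relatively open in its span: after expanding \<open>a\<close> in the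
  generators, all coefficients stay positive for small \<open>e\<close>.\<close>

lemma open_cone_diff_span:
  assumes "finite S" "y \<in> open_cone S" "a \<in> span S"
  shows "\<exists>e>0. y - e *\<^sub>R a \<in> open_cone S"
proof -
  obtain c where c: "\<forall>w\<in>S. 0 < c w" "y = (\<Sum>w\<in>S. c w *\<^sub>R w)"
    using assms(2) by (auto simp: comb_set_def)
  obtain u where u: "a = (\<Sum>w\<in>S. u w *\<^sub>R w)"
    using assms(3) by (auto simp: span_finite[OF assms(1)])
  obtain e where e: "e > 0" "\<forall>w\<in>S. 0 < c w - e * u w"
    using pos_perturb[OF assms(1), of c u] c(1) by blast
  have "y - e *\<^sub>R a = (\<Sum>w\<in>S. (c w - e * u w) *\<^sub>R w)"
    by (simp add: c(2) u scaleR_sum_right sum_subtractf scaleR_left_diff_distrib)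
  with e(2) have "y - e *\<^sub>R a \<in> open_cone S"
    unfolding comb_set_def by (intro CollectI exI[of _ "\<lambda>w. c w - e * u w"]) auto
  with e(1) show ?thesis by blast
qed

lemma comb_set_subset_span: "comb_set S I \<subseteq> span S"
  unfolding comb_set_def by (clarsimp, intro span_sum span_scale span_base)

text \<open>From any point of an open cone one can subtract a small multiple of any other; so a property
  that survives positive scaling and adding points of the cone holds everywhere or nowhere on it.\<close>
lemma open_cone_uniform:
  assumes "finite S" "y \<in> open_cone S" "z \<in> open_cone S" "A y"
    and "\<And>m v. m > 0 \<Longrightarrow> v \<in> open_cone S \<Longrightarrow> A (m *\<^sub>R y + v)"
  shows "A z"
proof -
  obtain e where "e > 0" "z - e *\<^sub>R y \<in> open_cone S"
    using open_cone_diff_span[OF assms(1,3), of y] comb_set_subset_span assms(2) by blast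
  from assms(5)[OF this] show ?thesis by simp
qed

lemma linear_comb_set:
  assumes "linear h" "\<And>w. w \<in> S \<Longrightarrow> h w = (1::real)"
  shows "h (\<Sum>w\<in>S. c w *\<^sub>R w) = sum c S"
  using assms by (simp add: linear_sum linear_cmul)

lemma convex_cone_hull_height_nonneg:
  assumes "linear h" "\<And>w. w \<in> W \<Longrightarrow> h w = (1::real)" "x \<in> convex_cone hull W"
  shows "0 \<le> h x"
proof -
  have "convex_cone {x. 0 \<le> h x}"
    using assms(1) by (auto simp: convex_cone_iff linear_add linear_cmul linear_0)
  then have "convex_cone hull W \<subseteq> {x. 0 \<le> h x}"
    using assms(2) by (intro hull_minimal) auto
  with assms(3) show ?thesis by auto
qed

section \<open>Adding one generator to a cone\<close>

lemma convex_cone_hull_singleton: "convex_cone hull {a} = {l *\<^sub>R a | l. 0 \<le> l}"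
  by (auto simp: convex_cone_hull_convex_hull_nonempty)

lemma convex_cone_hull_insert:
  "convex_cone hull (insert a W) = {y + l *\<^sub>R a | y l. y \<in> convex_cone hull W \<and> 0 \<le> l}"
  using convex_cone_hull_Un[of W "{a}"] by (auto simp: convex_cone_hull_singleton)

lemma apex_cone_eq:
  assumes "finite S" "a \<notin> S"
  shows "apex_cone a S = {y + l *\<^sub>R a | y l. y \<in> open_cone S \<and> 0 \<le> l}"
proof (intro set_eqI iffI)
  fix x assume "x \<in> apex_cone a S"
  then obtain c where c: "\<forall>w\<in>insert a S. c w \<in> (if w = a then {0..} else {0<..})"
    "x = (\<Sum>w\<in>insert a S. c w *\<^sub>R w)" unfolding comb_set_def by blast
  have "\<forall>w\<in>S. c w \<in> {0<..}" using c(1) assms(2) by (auto split: if_splits)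
  then have "(\<Sum>w\<in>S. c w *\<^sub>R w) \<in> open_cone S" unfolding comb_set_def by blast
  moreover have "x = (\<Sum>w\<in>S. c w *\<^sub>R w) + c a *\<^sub>R a" using c(2) assms by simp
  moreover have "0 \<le> c a" using c(1) by simp
  ultimately show "x \<in> {y + l *\<^sub>R a | y l. y \<in> open_cone S \<and> 0 \<le> l}" by blast
next
  fix x assume "x \<in> {y + l *\<^sub>R a | y l. y \<in> open_cone S \<and> 0 \<le> l}"
  then obtain c l where c: "\<forall>w\<in>S. 0 < c w" "x = (\<Sum>w\<in>S. c w *\<^sub>R w) + l *\<^sub>R a" "0 \<le> l"
    by (auto simp: comb_set_def)
  have "(\<Sum>w\<in>S. (c(a := l)) w *\<^sub>R w) = (\<Sum>w\<in>S. c w *\<^sub>R w)"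
    using assms(2) by (intro sum.cong) auto
  then have "x = (\<Sum>w\<in>insert a S. (c(a := l)) w *\<^sub>R w)" using c(2) assms by simp
  moreover have "\<forall>w\<in>insert a S. (c(a := l)) w \<in> (if w = a then {0..} else {0<..})"
    using c assms(2) by auto
  ultimately show "x \<in> apex_cone a S" unfolding comb_set_def by blast
qed

lemma open_cone_insert_eq:
  assumes "finite S" "a \<notin> S"
  shows "open_cone (insert a S) = {y + l *\<^sub>R a | y l. y \<in> open_cone S \<and> 0 < l}"
proof (intro set_eqI iffI)
  fix x assume "x \<in> open_cone (insert a S)"
  then obtain c where c: "\<forall>w\<in>insert a S. 0 < c w"
    "x = (\<Sum>w\<in>insert a S. c w *\<^sub>R w)" by (auto simp: comb_set_def)
  have "(\<Sum>w\<in>S. c w *\<^sub>R w) \<in> open_cone S" using c(1) by (auto simp: comb_set_def)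
  moreover have "x = (\<Sum>w\<in>S. c w *\<^sub>R w) + c a *\<^sub>R a" using c(2) assms by simp
  moreover have "0 < c a" using c(1) by simp
  ultimately show "x \<in> {y + l *\<^sub>R a | y l. y \<in> open_cone S \<and> 0 < l}" by blast
next
  fix x assume "x \<in> {y + l *\<^sub>R a | y l. y \<in> open_cone S \<and> 0 < l}"
  then obtain c l where c: "\<forall>w\<in>S. 0 < c w" "x = (\<Sum>w\<in>S. c w *\<^sub>R w) + l *\<^sub>R a" "0 < l"
    by (auto simp: comb_set_def)
  have "(\<Sum>w\<in>S. (c(a := l)) w *\<^sub>R w) = (\<Sum>w\<in>S. c w *\<^sub>R w)"
    using assms(2) by (intro sum.cong) auto
  then have "x = (\<Sum>w\<in>insert a S. (c(a := l)) w *\<^sub>R w)" using c(2) assms by simp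
  moreover have "\<forall>w\<in>insert a S. (c(a := l)) w \<in> {0<..}" using c assms(2) by auto
  ultimately show "x \<in> open_cone (insert a S)" unfolding comb_set_def by blast
qed

text \<open>These are the points where lines of direction \<open>a\<close> enter \<open>K\<close>.
  If \<open>a\<close> and the generators of a cone \<open>K\<close> have height 1, then in the
  cross-section at that height they are the points with nothing of \<open>K\<close> behind them as
  seen from \<open>a\<close>.\<close>

definition visible :: "'a::real_vector set \<Rightarrow> 'a \<Rightarrow> 'a set" where
  "visible K a = {y \<in> K. \<forall>e>0. y - e *\<^sub>R a \<notin> K}"

text \<open>Of two visible points on a line parallel to \<open>a\<close>, the one further along
  could be moved back onto the other without leaving \<open>K\<close>.\<close>

lemma visible_unique:
  assumes "y \<in> visible K a" "y' \<in> visible K a" "y + l *\<^sub>R a = y' + l' *\<^sub>R a"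
  shows "l = (l'::real)" "y = y'"
proof -
  have *: False if "y \<in> visible K a" "y' \<in> visible K a" "y + l *\<^sub>R a = y' + l' *\<^sub>R a" "l' < l"
    for y y' l l'
  proof -
    have "y' - (l - l') *\<^sub>R a = y" using that(3) by (simp add: algebra_simps)
    then show False using that unfolding visible_def by auto
  qed
  show "l = l'" using *[OF assms] *[OF assms(2,1) assms(3)[symmetric]] by (meson linorder_less_linear)
  with assms(3) show "y = y'" by simp
qed

text \<open>There is a largest multiple of \<open>a\<close> that can be subtracted from
  \<open>y\<close> within the cone: the admissible multiples form a closed set, as finitely
  generated cones are closed, and are at most \<open>h y\<close>, as heights in the cone are
  nonnegative.\<close>

lemma visible_translate_exists:
  fixes W :: "'a::euclidean_space set"
  assumes "finite W" "linear h" "\<And>w. w \<in> W \<Longrightarrow> h w = (1::real)" "h a = 1"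
    "y \<in> convex_cone hull W" "0 \<le> l"
  shows "\<exists>y' l'. y' \<in> visible (convex_cone hull W) a \<and> 0 \<le> l' \<and> y + l *\<^sub>R a = y' + l' *\<^sub>R a"
proof -
  let ?K = "convex_cone hull W"
  define L where "L = {m. 0 \<le> m \<and> y - m *\<^sub>R a \<in> ?K}"
  have "closed ((\<lambda>m. y - m *\<^sub>R a) -` ?K)"
    by (intro closed_vimage closed_convex_cone_hull assms(1)) (auto intro!: continuous_intros)
  then have "closed L"
  proof -
    have "L = {0..} \<inter> (\<lambda>m. y - m *\<^sub>R a) -` ?K" by (auto simp: L_def)
    with \<open>closed ((\<lambda>m. y - m *\<^sub>R a) -` ?K)\<close> show ?thesis by (simp only: closed_Int closed_atLeast)
  qed
  moreover have Lb: "m \<le> h y" if "m \<in> L" for m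
    using convex_cone_hull_height_nonneg[of h W "y - m *\<^sub>R a"] that assms(2-4)
    by (auto simp: L_def linear_diff linear_cmul)
  then have "bounded L"
    by (intro boundedI[of _ "h y"]) (auto simp: L_def)
  ultimately have "compact L" by (simp add: compact_eq_bounded_closed)
  moreover have "0 \<in> L" using assms(5) by (simp add: L_def)
  ultimately obtain m where m: "m \<in> L" "\<forall>m'\<in>L. m' \<le> m"
    using compact_attains_sup[of L] by auto
  have "y - m *\<^sub>R a \<in> visible ?K a"
    unfolding visible_def
  proof (intro CollectI conjI allI impI notI)
    fix e :: real assume "e > 0" "y - m *\<^sub>R a - e *\<^sub>R a \<in> ?K"
    then have "m + e \<in> L" using m(1) by (auto simp: L_def algebra_simps)
    with m(2) \<open>e > 0\<close> show False by force
  qed (use m in \<open>auto simp: L_def\<close>)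
  moreover have "y + l *\<^sub>R a = (y - m *\<^sub>R a) + (l + m) *\<^sub>R a" by (simp add: algebra_simps)
  moreover have "0 \<le> l + m" using m(1) assms(6) by (simp add: L_def)
  ultimately show ?thesis by blast
qed

text \<open>The empty set of generators is a legitimate piece: its open cone is the apex 0.\<close>

definition open_cone_partition :: "'a::real_vector set \<Rightarrow> 'a set set \<Rightarrow> bool" where
  "open_cone_partition W \<S> \<longleftrightarrow> (\<forall>S\<in>\<S>. S \<subseteq> W \<and> independent S) \<and>
     disjoint_family_on open_cone \<S> \<and> convex_cone hull W = (\<Union>S\<in>\<S>. open_cone S)"

text \<open>Subtracting from a point the largest possible multiple of \<open>a\<close> ends in the part of the old
  cone that is visible along \<open>a\<close>; this part is a union of pieces of the old partition.\<close>
lemma apex_cone_partition: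
  fixes W :: "'a::euclidean_space set"
  assumes "finite W" "linear h" "\<And>w. w \<in> W \<Longrightarrow> h w = (1::real)" "h a = 1"
    and part: "open_cone_partition W \<S>"
  defines "\<V> \<equiv> {S\<in>\<S>. open_cone S \<subseteq> visible (convex_cone hull W) a}"
  shows "\<forall>S\<in>\<V>. S \<subseteq> W \<and> a \<notin> S \<and> independent (insert a S)"
    and "disjoint_family_on (apex_cone a) \<V>"
    and "convex_cone hull (insert a W) = (\<Union>S\<in>\<V>. apex_cone a S)"
proof -
  let ?K = "convex_cone hull W"
  have S: "S \<subseteq> W" "independent S" "finite S" if "S \<in> \<S>" for S
    using part that assms(1) finite_subset unfolding open_cone_partition_def by auto
  have K: "?K = (\<Union>S\<in>\<S>. open_cone S)" and disj: "disjoint_family_on open_cone \<S>"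
    using part unfolding open_cone_partition_def by auto
  have ne: "open_cone S \<noteq> {}" for S :: "'a set"
    unfolding comb_set_def by (auto intro!: exI[of _ "\<lambda>_. 1"])
  show V: "\<forall>S\<in>\<V>. S \<subseteq> W \<and> a \<notin> S \<and> independent (insert a S)"
  proof
    fix S assume "S \<in> \<V>"
    then have S': "S \<in> \<S>" "open_cone S \<subseteq> visible ?K a" by (auto simp: \<V>_def)
    \<comment> \<open>Otherwise a small multiple of \<open>a\<close> could be subtracted without
      leaving the piece, against visibility.\<close>
    have "a \<notin> span S"
    proof
      assume a: "a \<in> span S"
      obtain y where y: "y \<in> open_cone S" using ne by blast
      obtain e where "e > 0" "y - e *\<^sub>R a \<in> open_cone S"
        using open_cone_diff_span[OF S(3)[OF S'(1)] y a] by blast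
      with S' y K show False unfolding visible_def by blast
    qed
    then show "S \<subseteq> W \<and> a \<notin> S \<and> independent (insert a S)"
      using S[OF S'(1)] by (auto simp: independent_insert span_base)
  qed
  have apex: "apex_cone a S = {y + l *\<^sub>R a | y l. y \<in> open_cone S \<and> 0 \<le> l}" if "S \<in> \<V>" for S
    using that V S(3) by (intro apex_cone_eq) (auto simp: \<V>_def)
  have vis: "visible ?K a = (\<Union>S\<in>\<V>. open_cone S)"
  proof (intro set_eqI iffI)
    fix y assume y: "y \<in> visible ?K a"
    then obtain S' where S': "S' \<in> \<S>" "y \<in> open_cone S'" using K by (auto simp: visible_def)
    have sub: "open_cone S' \<subseteq> ?K" using K S'(1) by blast
    \<comment> \<open>Visibility is constant on a piece: if one \<open>z\<close> can be moved back
      along \<open>a\<close> within the cone, then by \<open>open_cone_uniform\<close> so can every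
      point of the piece, in particular \<open>y\<close>.\<close>
    have "z \<in> visible ?K a" if z: "z \<in> open_cone S'" for z
    proof (rule ccontr)
      assume nz: "z \<notin> visible ?K a"
      have "\<exists>e>0. y - e *\<^sub>R a \<in> ?K"
      proof (rule open_cone_uniform[OF S(3)[OF S'(1)] z S'(2)])
        show "\<exists>e>0. z - e *\<^sub>R a \<in> ?K" using nz z sub by (auto simp: visible_def)
        then obtain e where e: "e > 0" "z - e *\<^sub>R a \<in> ?K" by blast
        fix m :: real and v assume m: "m > 0" "v \<in> open_cone S'"
        have "m *\<^sub>R z + v - (m * e) *\<^sub>R a = m *\<^sub>R (z - e *\<^sub>R a) + v"
          by (simp add: algebra_simps)
        also have "\<dots> \<in> ?K"
          using e m sub by (intro convex_cone_hull_add convex_cone_hull_mul) auto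
        finally show "\<exists>e>0. m *\<^sub>R z + v - e *\<^sub>R a \<in> ?K" using e m by (intro exI[of _ "m * e"]) auto
      qed
      with y show False by (auto simp: visible_def)
    qed
    with S' show "y \<in> (\<Union>S\<in>\<V>. open_cone S)" by (auto simp: \<V>_def)
  qed (auto simp: \<V>_def)
  show "disjoint_family_on (apex_cone a) \<V>"
    unfolding disjoint_family_on_def
  proof (intro ballI impI)
    fix S S' assume SS: "S \<in> \<V>" "S' \<in> \<V>" "S \<noteq> S'"
    have "open_cone S \<inter> open_cone S' = {}"
      using disj SS by (auto simp: disjoint_family_on_def \<V>_def)
    moreover have "open_cone S \<subseteq> visible ?K a" "open_cone S' \<subseteq> visible ?K a"
      using SS by (auto simp: \<V>_def)
    ultimately show "apex_cone a S \<inter> apex_cone a S' = {}"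
      unfolding apex[OF SS(1)] apex[OF SS(2)] using visible_unique(2)[of _ ?K a] by blast
  qed
  show "convex_cone hull (insert a W) = (\<Union>S\<in>\<V>. apex_cone a S)"
  proof (intro set_eqI iffI)
    fix x assume "x \<in> convex_cone hull (insert a W)"
    then obtain y l where yl: "x = y + l *\<^sub>R a" "y \<in> ?K" "0 \<le> l"
      by (auto simp: convex_cone_hull_insert)
    obtain y' l' where "y' \<in> visible ?K a" "0 \<le> l'" "x = y' + l' *\<^sub>R a"
      using visible_translate_exists[OF assms(1-4) yl(2,3)] yl(1) by auto
    then show "x \<in> (\<Union>S\<in>\<V>. apex_cone a S)" using apex unfolding vis by blast
  next
    fix x assume "x \<in> (\<Union>S\<in>\<V>. apex_cone a S)"
    then obtain S where S': "S \<in> \<V>" "x \<in> apex_cone a S" by blast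
    then obtain y l where "x = y + l *\<^sub>R a" "y \<in> open_cone S" "0 \<le> l" using apex by blast
    moreover have "open_cone S \<subseteq> ?K" using S'(1) K by (auto simp: \<V>_def)
    ultimately show "x \<in> convex_cone hull (insert a W)" unfolding convex_cone_hull_insert by blast
  qed
qed

text \<open>Generators are inserted one by one. Each apex cone over a visible piece \<open>S\<close>
  splits, according to whether the coefficient of \<open>a\<close> is zero or positive, into the
  open cones on \<open>S\<close> and on \<open>insert a S\<close>. Old pieces that are not visible
  are dropped, since the apex cones cover them.\<close>

lemma open_cone_partition_exists:
  fixes W :: "'a::euclidean_space set"
  assumes "finite W" "linear h" "\<And>w. w \<in> W \<Longrightarrow> h w = (1::real)"
  shows "\<exists>\<S>. open_cone_partition W \<S>"
  using assms(1,3)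
proof (induction W rule: finite_induct)
  case empty
  have "open_cone_partition {} {{} :: 'a set}"
    by (auto simp: open_cone_partition_def disjoint_family_on_def comb_set_def independent_empty)
  then show ?case by blast
next
  case (insert a W)
  from insert.IH insert.prems obtain \<S> where part: "open_cone_partition W \<S>" by auto
  have h1: "\<And>w. w \<in> W \<Longrightarrow> h w = 1" "h a = 1" using insert.prems by auto
  define \<V> where "\<V> = {S\<in>\<S>. open_cone S \<subseteq> visible (convex_cone hull W) a}"
  note V = apex_cone_partition[OF insert.hyps(1) assms(2) h1 part, folded \<V>_def]
  have fin: "finite S" "a \<notin> S" if "S \<in> \<V>" for S
    using V(1) that insert.hyps(1) finite_subset by auto
  have vis: "open_cone S \<subseteq> visible (convex_cone hull W) a" if "S \<in> \<V>" for S
    using that by (auto simp: \<V>_def)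
  have split: "apex_cone a S = open_cone S \<union> open_cone (insert a S)" if "S \<in> \<V>" for S
  proof -
    have "{y + l *\<^sub>R a | y l. y \<in> X \<and> 0 \<le> l} = X \<union> {y + l *\<^sub>R a | y l. y \<in> X \<and> 0 < l}" for X
      by (force simp: le_less)
    then show ?thesis
      unfolding apex_cone_eq[OF fin[OF that]] open_cone_insert_eq[OF fin[OF that]] .
  qed
  \<comment> \<open>A visible point moved by a positive multiple of \<open>a\<close> is no longer
    visible.\<close>
  have dis: "open_cone S \<inter> open_cone (insert a S) = {}" if "S \<in> \<V>" for S
  proof -
    have "y = y' + l *\<^sub>R a \<Longrightarrow> y \<in> open_cone S \<Longrightarrow> y' \<in> open_cone S \<Longrightarrow> \<not> 0 < l" for y y' l
      using visible_unique(1)[of y "convex_cone hull W" a y' 0 l] vis[OF that] by auto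
    then show ?thesis unfolding open_cone_insert_eq[OF fin[OF that]] by blast
  qed
  have "open_cone_partition (insert a W) (\<V> \<union> insert a ` \<V>)"
    unfolding open_cone_partition_def
  proof (intro conjI)
    show "\<forall>S\<in>\<V> \<union> insert a ` \<V>. S \<subseteq> insert a W \<and> independent S"
      using V(1) independent_mono by blast
    show "convex_cone hull insert a W = \<Union> (open_cone ` (\<V> \<union> insert a ` \<V>))"
    proof -
      have "(\<Union>S\<in>\<V>. apex_cone a S) = (\<Union>S\<in>\<V>. open_cone S \<union> open_cone (insert a S))"
        by (rule SUP_cong[OF refl]) (rule split)
      then show ?thesis using V(3) by auto
    qed
    have D: "open_cone S \<inter> open_cone S' = {}" "open_cone S \<inter> open_cone (insert a S') = {}"
      "open_cone (insert a S) \<inter> open_cone (insert a S') = {}"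
      if "S \<in> \<V>" "S' \<in> \<V>" "S \<noteq> S'" for S S'
    proof -
      have "apex_cone a S \<inter> apex_cone a S' = {}"
        using V(2) that unfolding disjoint_family_on_def by blast
      then show "open_cone S \<inter> open_cone S' = {}" "open_cone S \<inter> open_cone (insert a S') = {}"
        "open_cone (insert a S) \<inter> open_cone (insert a S') = {}"
        unfolding split[OF that(1)] split[OF that(2)] by auto
    qed
    show "disjoint_family_on open_cone (\<V> \<union> insert a ` \<V>)"
      unfolding disjoint_family_on_def
    proof (intro ballI impI)
      fix T T' assume T: "T \<in> \<V> \<union> insert a ` \<V>" "T' \<in> \<V> \<union> insert a ` \<V>" "T \<noteq> T'"
      from T(1,2) show "open_cone T \<inter> open_cone T' = {}"
      proof (elim UnE imageE)
        assume "T \<in> \<V>" "T' \<in> \<V>"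
        then show ?thesis using D(1) T(3) by blast
      next
        fix S' assume "T \<in> \<V>" "S' \<in> \<V>" "T' = insert a S'"
        then show ?thesis using D(2)[of T S'] dis[of T] by (cases "T = S'") auto
      next
        fix S assume "S \<in> \<V>" "T' \<in> \<V>" "T = insert a S"
        then show ?thesis using D(2)[of T' S] dis[of T'] by (cases "T' = S") (auto simp: Int_commute)
      next
        fix S S' assume "S \<in> \<V>" "S' \<in> \<V>" "T = insert a S" "T' = insert a S'"
        then show ?thesis using D(3)[of S S'] T(3) by auto
      qed
    qed
  qed
  then show ?case by blast
qed

section \<open>Lattice points of simplicial cones\<close>

text \<open>Only \<open>x\<close> has to be integral; the height \<open>s\<close> is any real, which
  accommodates real dilation factors.\<close>

definition slice :: "(real \<times> (real ^ 'n)) set \<Rightarrow> real \<Rightarrow> (real ^ 'n) set" where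
  "slice X s = {x \<in> int_lattice. (s, x) \<in> X}"

lemma int_lattice_add: "x \<in> int_lattice \<Longrightarrow> y \<in> int_lattice \<Longrightarrow> x + y \<in> int_lattice"
  and int_lattice_diff: "x \<in> int_lattice \<Longrightarrow> y \<in> int_lattice \<Longrightarrow> x - y \<in> int_lattice"
  by (auto simp: int_lattice_def)

lemma finite_int_lattice_bounded: "finite {x \<in> int_lattice. norm (x :: real ^ 'n) \<le> B}"
proof -
  have "{x \<in> int_lattice. norm (x :: real ^ 'n) \<le> B} \<subseteq>
      vec_lambda ` (PiE UNIV (\<lambda>_. {z \<in> \<int>. - B \<le> z \<and> z \<le> B}))"
  proof
    fix x :: "real ^ 'n" assume x: "x \<in> {x \<in> int_lattice. norm x \<le> B}"
    have "vec_nth x i \<in> {z \<in> \<int>. - B \<le> z \<and> z \<le> B}" for i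
      using x component_le_norm_cart[of x i] by (auto simp: int_lattice_def abs_le_iff)
    then have "vec_nth x \<in> PiE UNIV (\<lambda>_. {z \<in> \<int>. - B \<le> z \<and> z \<le> B})" by auto
    then show "x \<in> vec_lambda ` (PiE UNIV (\<lambda>_. {z \<in> \<int>. - B \<le> z \<and> z \<le> B}))"
      by (intro image_eqI[of _ _ "vec_nth x"]) auto
  qed
  moreover have "finite (PiE (UNIV :: 'n set) (\<lambda>_. {z \<in> \<int>. - B \<le> z \<and> z \<le> B}))"
    by (intro finite_PiE finite_int_segment) auto
  ultimately show ?thesis using finite_surj by blast
qed

text \<open>Nonnegative coefficients of generators of height 1 add up to \<open>s\<close>, so each
  is at most \<open>s\<close> and the slice is bounded. Finiteness matters because
  \<open>card\<close> is 0 on infinite sets.\<close>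

lemma finite_slice_comb_set:
  fixes S :: "(real \<times> (real ^ 'n)) set"
  assumes "finite S" "\<And>w. w \<in> S \<Longrightarrow> fst w = 1" "\<And>w. w \<in> S \<Longrightarrow> I w \<subseteq> {0..}"
  shows "finite (slice (comb_set S I) s)"
proof (rule finite_subset[OF _ finite_int_lattice_bounded])
  show "slice (comb_set S I) s \<subseteq> {x \<in> int_lattice. norm x \<le> (\<Sum>w\<in>S. s * norm (snd w))}"
  proof
    fix x assume "x \<in> slice (comb_set S I) s"
    then obtain c where x: "x \<in> int_lattice" and c: "\<forall>w\<in>S. c w \<in> I w" "(s, x) = (\<Sum>w\<in>S. c w *\<^sub>R w)"
      by (auto simp: slice_def comb_set_def)
    have c0: "0 \<le> c w" if "w \<in> S" for w using c(1) assms(3) that by fastforce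
    have "s = sum c S"
      using linear_comb_set[OF linear_fst, of S c] assms(2) c(2) by (metis fst_conv)
    then have cs: "c w \<le> s" if "w \<in> S" for w
      using that c0 assms(1) by (auto intro: member_le_sum)
    have "x = (\<Sum>w\<in>S. c w *\<^sub>R snd w)"
      using c(2) by (metis (no_types, lifting) snd_conv snd_sum sum.cong snd_scaleR)
    also have "norm \<dots> \<le> (\<Sum>w\<in>S. s * norm (snd w))"
      by (rule order_trans[OF norm_sum]) (auto intro!: sum_mono mult_right_mono simp: c0 cs)
    finally show "x \<in> {x \<in> int_lattice. norm x \<le> (\<Sum>w\<in>S. s * norm (snd w))}" using x by blast
  qed
qed

section \<open>Translating combinations by a generator\<close>

lemma mem_plus_one_image_iff: "x \<in> (+) 1 ` X \<longleftrightarrow> x - 1 \<in> X" for x :: real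
  by force

lemma comb_set_shift:
  assumes "finite S" "v \<in> S"
  shows "comb_set S (I(v := (+) 1 ` X)) = (+) v ` comb_set S (I(v := X))"
proof (intro set_eqI iffI)
  have sum_upd: "(\<Sum>w\<in>S. (c(v := r)) w *\<^sub>R w) = (\<Sum>w\<in>S. c w *\<^sub>R w) + (r - c v) *\<^sub>R v" for c r
    using assms by (simp add: sum.remove[OF assms(1,2)] algebra_simps)
  { fix x assume "x \<in> comb_set S (I(v := (+) 1 ` X))"
    then obtain c where c: "\<forall>w\<in>S. c w \<in> (I(v := (+) 1 ` X)) w" "x = (\<Sum>w\<in>S. c w *\<^sub>R w)"
      unfolding comb_set_def by blast
    have "\<forall>w\<in>S. (c(v := c v - 1)) w \<in> (I(v := X)) w"
      using c(1) by (auto simp: mem_plus_one_image_iff)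
    then have "(\<Sum>w\<in>S. (c(v := c v - 1)) w *\<^sub>R w) \<in> comb_set S (I(v := X))"
      unfolding comb_set_def by blast
    moreover have "x = v + (\<Sum>w\<in>S. (c(v := c v - 1)) w *\<^sub>R w)" unfolding sum_upd c(2) by simp
    ultimately show "x \<in> (+) v ` comb_set S (I(v := X))" by blast }
  { fix x assume "x \<in> (+) v ` comb_set S (I(v := X))"
    then obtain c where c: "\<forall>w\<in>S. c w \<in> (I(v := X)) w" "x = v + (\<Sum>w\<in>S. c w *\<^sub>R w)"
      unfolding comb_set_def by blast
    have "\<forall>w\<in>S. (c(v := c v + 1)) w \<in> (I(v := (+) 1 ` X)) w"
      using c(1) by (auto simp: mem_plus_one_image_iff)
    moreover have "x = (\<Sum>w\<in>S. (c(v := c v + 1)) w *\<^sub>R w)" unfolding sum_upd c(2) by simp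
    ultimately show "x \<in> comb_set S (I(v := (+) 1 ` X))" unfolding comb_set_def by blast }
qed

lemma comb_set_Un:
  assumes "v \<in> S"
  shows "comb_set S (I(v := X \<union> Y)) = comb_set S (I(v := X)) \<union> comb_set S (I(v := Y))"
proof -
  have "(\<forall>w\<in>S. c w \<in> (I(v := X \<union> Y)) w) \<longleftrightarrow>
      (\<forall>w\<in>S. c w \<in> (I(v := X)) w) \<or> (\<forall>w\<in>S. c w \<in> (I(v := Y)) w)" for c
    using assms by auto
  then show ?thesis unfolding comb_set_def by blast
qed

lemma comb_set_disjoint:
  assumes "finite S" "independent S" "v \<in> S" "X \<inter> Y = {}"
  shows "comb_set S (I(v := X)) \<inter> comb_set S (I(v := Y)) = {}"
proof (rule ccontr)
  assume "comb_set S (I(v := X)) \<inter> comb_set S (I(v := Y)) \<noteq> {}"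
  then obtain b c where bc: "\<forall>w\<in>S. b w \<in> (I(v := X)) w" "\<forall>w\<in>S. c w \<in> (I(v := Y)) w"
    "(\<Sum>w\<in>S. b w *\<^sub>R w) = (\<Sum>w\<in>S. c w *\<^sub>R w)"
    unfolding comb_set_def by blast
  have "(\<Sum>w\<in>S. (b w - c w) *\<^sub>R w) = 0"
    using bc(3) by (simp add: scaleR_left_diff_distrib sum_subtractf)
  from independentD[OF assms(2,1) order_refl this assms(3)] have "b v = c v" by simp
  moreover have "b v \<in> X" "c v \<in> Y" using bc(1,2) assms(3) by (metis fun_upd_same)+
  ultimately show False using assms(4) by auto
qed

text \<open>Translation by an integral vector of height 1 matches lattice points at height
  \<open>s - 1\<close> with those at height \<open>s\<close>; this is the source of the difference
  equation for the counts.\<close>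

lemma slice_shift:
  assumes "fst v = 1" "snd v \<in> int_lattice"
  shows "slice ((+) v ` X) s = (+) (snd v) ` slice X (s - 1)"
proof (intro set_eqI iffI)
  fix x assume "x \<in> slice ((+) v ` X) s"
  then obtain y where y: "x \<in> int_lattice" "y \<in> X" "(s, x) = v + y" by (auto simp: slice_def)
  from y(3) assms(1) have "y = (s - 1, x - snd v)" by (auto simp: prod_eq_iff algebra_simps)
  with y assms(2) have "x - snd v \<in> slice X (s - 1)" by (simp add: slice_def int_lattice_diff)
  then show "x \<in> (+) (snd v) ` slice X (s - 1)" by (auto intro!: image_eqI[of _ _ "x - snd v"])
next
  fix x assume "x \<in> (+) (snd v) ` slice X (s - 1)"
  then obtain z where z: "x = snd v + z" "z \<in> int_lattice" "(s - 1, z) \<in> X" by (auto simp: slice_def)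
  have "(s, x) = v + (s - 1, z)" using z(1) assms(1) by (simp add: prod_eq_iff)
  with z assms(2) show "x \<in> slice ((+) v ` X) s" unfolding slice_def by (auto simp: int_lattice_add)
qed

text \<open>Releasing one after the other the coefficients of a half-open parallelepiped multiplies the
  generating function by a geometric series, i.e. takes an antidifference.\<close>
lemma quasi_poly_on_card_slice:
  fixes S A :: "(real \<times> (real ^ 'n)) set"
  assumes "finite S" "independent S" and gen: "\<And>w. w \<in> S \<Longrightarrow> fst w = 1 \<and> snd w \<in> int_lattice"
    and "A \<subseteq> S"
  shows "quasi_poly_on (card S) (if A = {} then {0<..} else {0..})
    (\<lambda>s. real (card (slice (comb_set S (\<lambda>w. if w \<in> A then {0..} else {0<..})) s)))"
proof -
  \<comment> \<open>\<open>J w\<close> is a fundamental interval for unit steps in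
    \<open>U w\<close>, open at the right or left end according to \<open>U w\<close>, so that
    \<open>U w\<close> is the disjoint union of \<open>J w\<close> and its own translate by
    1.\<close>
  define U J :: "real \<times> (real ^ 'n) \<Rightarrow> real set"
    where "U w = (if w \<in> A then {0..} else {0<..})" and "J w = (if w \<in> A then {0..<1} else {0<..1})"
    for w
  \<comment> \<open>Coefficients of generators in \<open>T\<close> are released: \<open>I {}\<close>
    gives the parallelepiped and \<open>I S\<close> the whole cone.\<close>
  define I where "I T w = (if w \<in> T then U w else J w)" for T w
  define D :: "real set" where "D = (if A = {} then {0<..} else {0..})"
  have I0: "I T w \<subseteq> {0..}" for T w by (auto simp: I_def U_def J_def)
  have U: "U v = J v \<union> (+) 1 ` U v" for v
  proof -
    have "{0..} = {0..<1} \<union> (+) 1 ` {0::real..}" "{0<..} = {0<..1} \<union> (+) 1 ` {0::real<..}"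
      by (auto simp: mem_plus_one_image_iff)
    then show ?thesis unfolding U_def J_def by presburger
  qed
  have JU: "J v \<inter> (+) 1 ` U v = {}" for v by (auto simp: U_def J_def)
  \<comment> \<open>With \<open>card T\<close> coefficients released the formula holds from height
    \<open>card S - card T\<close> on, hence from 0 on when \<open>T = S\<close>; \<open>D\<close>
    decides whether the bound itself is included.\<close>
  have qp: "quasi_poly_on (card T) {s. s + real (card T) - real (card S) \<in> D} (\<lambda>s. real (card (slice (comb_set S (I T)) s)))"
    if "finite T" "T \<subseteq> S" for T
    using that
  proof (induction T rule: finite_induct)
    case empty
    \<comment> \<open>Heights in the parallelepiped are at most \<open>card S\<close>, and strictly
      less once some coefficient ranges over [0, 1). This is why \<open>D\<close> contains 0 exactly
      when \<open>A\<close> is nonempty.\<close>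
    have "slice (comb_set S (I {})) s = {}" if s: "s - real (card S) \<in> D" for s
    proof (rule ccontr)
      assume "slice (comb_set S (I {})) s \<noteq> {}"
      then obtain x c where c: "\<forall>w\<in>S. c w \<in> J w" "(s, x) = (\<Sum>w\<in>S. c w *\<^sub>R w)"
        by (auto simp: slice_def comb_set_def I_def)
      have sc: "s = sum c S"
        using linear_comb_set[OF linear_fst, of S c] gen arg_cong[OF c(2), of fst] by simp
      have c1: "c w \<le> 1" "w \<in> A \<Longrightarrow> c w < 1" if "w \<in> S" for w
        using c(1) that unfolding J_def by (fastforce split: if_splits)+
      have "sum c S \<le> (\<Sum>w\<in>S. 1)" by (intro sum_mono c1)
      moreover have "sum c S < (\<Sum>w\<in>S. 1)" if "A \<noteq> {}"
      proof (rule sum_strict_mono_ex1[OF assms(1)])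
        from that obtain w where "w \<in> A" by blast
        with assms(4) c1(2) show "\<exists>w\<in>S. c w < 1" by blast
      qed (use c1(1) in blast)
      ultimately show False using s sc by (auto simp: D_def split: if_splits)
    qed
    then show ?case by (intro quasi_poly_on_zero) simp
  next
    case (insert v T)
    let ?F = "\<lambda>T s. real (card (slice (comb_set S (I T)) s))"
    have v: "v \<in> S" "fst v = 1" "snd v \<in> int_lattice" using insert.prems gen by auto
    have Iv: "I (insert v T) = (I T)(v := U v)" and IT: "I T = (I T)(v := J v)"
      using insert.hyps by (auto simp: I_def fun_eq_iff)
    have "comb_set S (I (insert v T)) = comb_set S ((I T)(v := J v \<union> (+) 1 ` U v))"
      unfolding Iv by (rule arg_cong[OF U[of v], of "\<lambda>X. comb_set S ((I T)(v := X))"])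
    also have "\<dots> = comb_set S (I T) \<union> (+) v ` comb_set S (I (insert v T))"
      unfolding comb_set_Un[OF v(1)] comb_set_shift[OF assms(1) v(1)] Iv by (simp flip: IT)
    finally have eq: "comb_set S (I (insert v T)) = comb_set S (I T) \<union> (+) v ` comb_set S (I (insert v T))" .
    have dj: "comb_set S (I T) \<inter> (+) v ` comb_set S (I (insert v T)) = {}"
      using comb_set_disjoint[OF assms(1,2) v(1) JU[of v], of "I T"]
      unfolding comb_set_shift[OF assms(1) v(1)] Iv by (simp flip: IT)
    have diff: "?F (insert v T) s - ?F (insert v T) (s - 1) = ?F T s" for s
    proof -
      have "slice (comb_set S (I (insert v T))) s
          = slice (comb_set S (I T)) s \<union> slice ((+) v ` comb_set S (I (insert v T))) s"
        by (subst eq) (auto simp: slice_def)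
      also have "\<dots> = slice (comb_set S (I T)) s \<union> (+) (snd v) ` slice (comb_set S (I (insert v T))) (s - 1)"
        by (simp add: slice_shift[OF v(2,3)])
      finally have "card (slice (comb_set S (I (insert v T))) s) = card (slice (comb_set S (I T)) s
          \<union> (+) (snd v) ` slice (comb_set S (I (insert v T))) (s - 1))" by simp
      also have "\<dots> = card (slice (comb_set S (I T)) s)
          + card ((+) (snd v) ` slice (comb_set S (I (insert v T))) (s - 1))"
      proof (rule card_Un_disjoint)
        show "finite (slice (comb_set S (I T)) s)"
          "finite ((+) (snd v) ` slice (comb_set S (I (insert v T))) (s - 1))"
          using finite_slice_comb_set[OF assms(1) _ I0] gen by auto
        show "slice (comb_set S (I T)) s \<inter> (+) (snd v) ` slice (comb_set S (I (insert v T))) (s - 1) = {}"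
          unfolding slice_shift[OF v(2,3), symmetric] using dj by (auto simp: slice_def)
      qed
      finally show ?thesis by (simp add: card_image)
    qed
    have "quasi_poly_on (Suc (card T)) {s. s + 1 \<in> {s. s + real (card T) - real (card S) \<in> D}} (?F (insert v T))"
    proof (rule quasi_poly_on_antidifference)
      show "quasi_poly_on (card T) {s. s + real (card T) - real (card S) \<in> D} (?F T)"
        using insert by simp
    qed (auto simp: diff D_def split: if_splits)
    then show ?case using insert.hyps by (simp add: algebra_simps)
  qed
  have "comb_set S (I S) = comb_set S (\<lambda>w. if w \<in> A then {0..} else {0<..})"
    by (simp add: comb_set_def I_def U_def)
  with qp[OF assms(1) order_refl] show ?thesis
    by (simp add: D_def)
qed

section \<open>Dilated polytopes\<close>

lemma card_slice_UN:
  assumes "finite \<V>" "\<And>S. S \<in> \<V> \<Longrightarrow> finite (slice (X S) s)" "disjoint_family_on X \<V>"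
  shows "card (slice (\<Union>S\<in>\<V>. X S) s) = (\<Sum>S\<in>\<V>. card (slice (X S) s))"
proof -
  have "slice (\<Union>S\<in>\<V>. X S) s = (\<Union>S\<in>\<V>. slice (X S) s)" by (auto simp: slice_def)
  also have "card \<dots> = (\<Sum>S\<in>\<V>. card (slice (X S) s))"
    using assms by (intro card_UN_disjoint) (auto simp: slice_def disjoint_family_on_def)
  finally show ?thesis .
qed

text \<open>An affine dependence of the second components has coefficients with sum 0, so at common
  height 1 it is a linear dependence of the pairs. Hence the second components are affinely
  independent.\<close>

lemma card_independent_height_one_le:
  fixes V :: "('a::euclidean_space) set"
  assumes "S \<subseteq> {1::real} \<times> V" "independent S" "finite S"
  shows "card S \<le> Suc (nat (aff_dim V))"
proof -
  have inj: "inj_on snd S" using assms(1) by (auto simp: inj_on_def)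
  have "\<not> affine_dependent (snd ` S)"
  proof
    assume "affine_dependent (snd ` S)"
    then obtain u x where u: "sum u (snd ` S) = 0" "x \<in> snd ` S" "u x \<noteq> 0"
      "(\<Sum>v\<in>snd ` S. u v *\<^sub>R v) = 0"
      using affine_dependent_explicit_finite[of "snd ` S"] assms(3) by auto
    have "sum (\<lambda>w. u (snd w)) S = 0" "(\<Sum>w\<in>S. u (snd w) *\<^sub>R snd w) = 0"
      using u(1,4) by (simp_all add: sum.reindex[OF inj])
    moreover have "(\<Sum>w\<in>S. u (snd w) *\<^sub>R w) = (\<Sum>w\<in>S. (u (snd w), u (snd w) *\<^sub>R snd w))"
      using assms(1) by (intro sum.cong) (auto simp: prod_eq_iff)
    ultimately have "(\<Sum>w\<in>S. u (snd w) *\<^sub>R w) = 0"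
      by (simp add: sum_prod zero_prod_def)
    with u(2,3) independentD[OF assms(2,3) order_refl, of "\<lambda>w. u (snd w)"] show False by auto
  qed
  then have "int (card (snd ` S)) \<le> aff_dim V + 1"
    using assms(1) by (intro independent_card_le_aff_dim) auto
  then show ?thesis by (simp add: card_image[OF inj])
qed

lemma convex_cone_hull_height_one:
  assumes "V \<noteq> {}"
  shows "convex_cone hull ({1::real} \<times> V) = {(s, s *\<^sub>R x) | s x. 0 \<le> s \<and> x \<in> convex hull V}"
  using assms by (force simp: convex_cone_hull_convex_hull_nonempty convex_hull_Times)

text \<open>After division by \<open>s + s'\<close> the sum lies on the segment from
  \<open>x'\<close> to \<open>x\<close>, with positive weight on the relative interior point
  \<open>x\<close>.\<close>

lemma rel_interior_add_cone:
  fixes Q :: "'a::euclidean_space set"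
  assumes "convex Q" "s > 0" "x \<in> rel_interior Q" "s' \<ge> 0" "x' \<in> Q"
  shows "\<exists>z\<in>rel_interior Q. s *\<^sub>R x + s' *\<^sub>R x' = (s + s') *\<^sub>R z"
proof
  let ?e = "s / (s + s')"
  show "x' - ?e *\<^sub>R (x' - x) \<in> rel_interior Q"
    using assms by (intro rel_interior_convex_shrink) auto
  have "(s + s') *\<^sub>R (x' - ?e *\<^sub>R (x' - x)) = (s + s') *\<^sub>R x' - ((s + s') * ?e) *\<^sub>R (x' - x)"
    by (simp add: scaleR_diff_right)
  also have "(s + s') * ?e = s" using assms by simp
  finally show "s *\<^sub>R x + s' *\<^sub>R x' = (s + s') *\<^sub>R (x' - ?e *\<^sub>R (x' - x))"
    by (simp add: algebra_simps)
qed

text \<open>The slice at height \<open>s\<close> of the cone over \<open>Q\<close> is the set of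
  lattice points of \<open>dilate s Q\<close>. Each piece of the partition has at most dim Q + 1
  generators, so its count has degree at most dim Q.\<close>

lemma quasi_poly_on_lattice_count:
  fixes V :: "(real ^ 'n) set"
  assumes "finite V" "V \<noteq> {}" "V \<subseteq> int_lattice"
  defines "Q \<equiv> convex hull V"
  shows "quasi_poly_on (Suc (poly_dim Q)) {0..} (\<lambda>s. real (lattice_count Q s))"
    and "quasi_poly_on (Suc (poly_dim Q)) {0<..} (\<lambda>s. real (lattice_count (rel_interior Q) s))"
proof -
  let ?W = "{1::real} \<times> V"
  let ?K = "convex_cone hull ?W"
  have K: "?K = {(s, s *\<^sub>R x) | s x. 0 \<le> s \<and> x \<in> Q}"
    unfolding Q_def by (rule convex_cone_hull_height_one[OF assms(2)])
  have dimQ: "poly_dim Q = nat (aff_dim V)" by (simp add: poly_dim_def Q_def aff_dim_convex_hull)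
  have finW: "finite ?W" using assms(1) by simp
  have W1: "fst w = 1" "snd w \<in> int_lattice" if "w \<in> ?W" for w using that assms(3) by auto
  have bound: "card S \<le> Suc (poly_dim Q)" if "S \<subseteq> ?W" "independent S" for S
    unfolding dimQ using that finite_subset[OF that(1) finW] by (rule card_independent_height_one_le)

  \<comment> \<open>The generator \<open>(1, a)\<close> enters last: pieces that are closed in its direction give quasi-polynomials
    valid also at \<open>s = 0\<close>, unlike open simplicial cones.\<close>
  obtain a V' where V': "V = insert a V'" "a \<notin> V'" using assms(2) by (meson ex_in_conv mk_disjoint_insert)
  let ?W' = "{1::real} \<times> V'"
  have W': "?W = insert (1, a) ?W'" "finite ?W'" using V' assms(1) by auto
  have W1': "\<And>w. w \<in> ?W' \<Longrightarrow> fst w = 1" "fst (1::real, a) = 1" by auto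
  obtain \<S>' where "open_cone_partition ?W' \<S>'"
    using open_cone_partition_exists[OF W'(2) linear_fst] by auto
  note part = apex_cone_partition[OF W'(2) linear_fst W1'(1) W1'(2) this]
  define \<V> where "\<V> = {S\<in>\<S>'. open_cone S \<subseteq> visible (convex_cone hull ?W') (1, a)}"
  have V1: "S \<subseteq> ?W'" "(1, a) \<notin> S" "independent (insert (1, a) S)" if "S \<in> \<V>" for S
    using part(1) that unfolding \<V>_def by auto
  have V2: "disjoint_family_on (apex_cone (1, a)) \<V>" using part(2) unfolding \<V>_def .
  have V3: "?K = (\<Union>S\<in>\<V>. apex_cone (1, a) S)" using part(3) unfolding \<V>_def W'(1) .
  have finV: "finite \<V>"
    by (rule finite_subset[of _ "Pow ?W'"]) (use V1(1) W'(2) in auto)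
  have insW: "insert (1, a) S \<subseteq> ?W" if "S \<in> \<V>" for S using V1(1)[OF that] W'(1) by blast
  have "quasi_poly_on (Suc (poly_dim Q)) {0..} (\<lambda>s. \<Sum>S\<in>\<V>. real (card (slice (apex_cone (1, a) S) s)))"
  proof (rule quasi_poly_on_sum)
    fix S assume S: "S \<in> \<V>"
    have "quasi_poly_on (card (insert (1, a) S)) (if {(1::real, a)} = {} then {0<..} else {0..})
      (\<lambda>s. real (card (slice (comb_set (insert (1, a) S) (\<lambda>w. if w \<in> {(1, a)} then {0..} else {0<..})) s)))"
      by (rule quasi_poly_on_card_slice)
        (use V1(3)[OF S] insW[OF S] W1 finite_subset[OF insW[OF S] finW] in auto)
    then show "quasi_poly_on (Suc (poly_dim Q)) {0..} (\<lambda>s. real (card (slice (apex_cone (1, a) S) s)))"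
      by (rule quasi_poly_on_mono) (use bound[OF insW[OF S] V1(3)[OF S]] in auto)
  qed
  then show "quasi_poly_on (Suc (poly_dim Q)) {0..} (\<lambda>s. real (lattice_count Q s))"
  proof (rule quasi_poly_on_mono)
    fix s :: real assume "s \<in> {0..}"
    then have "dilate s Q \<inter> int_lattice = slice ?K s"
      unfolding K by (auto simp: slice_def dilate_def)
    also have "card \<dots> = (\<Sum>S\<in>\<V>. card (slice (apex_cone (1, a) S) s))"
      unfolding V3 using finV V2
    proof (intro card_slice_UN)
      fix S assume S: "S \<in> \<V>"
      show "finite (slice (apex_cone (1, a) S) s)"
        by (rule finite_slice_comb_set) (use insW[OF S] W1 finite_subset[OF insW[OF S] finW] in auto)
    qed
    finally show "s \<in> {0..} \<and> real (lattice_count Q s) = (\<Sum>S\<in>\<V>. real (card (slice (apex_cone (1, a) S) s)))"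
      using \<open>s \<in> {0..}\<close> by (simp add: lattice_count_def)
  qed simp

  \<comment> \<open>The cone over the relative interior, without its apex.\<close>
  define R where "R = {(s, s *\<^sub>R x) | s x. 0 < s \<and> x \<in> rel_interior Q}"
  obtain \<S> where part: "open_cone_partition ?W \<S>"
    using open_cone_partition_exists[OF finW linear_fst] by auto
  have S1: "S \<subseteq> ?W" "independent S" "finite S" if "S \<in> \<S>" for S
    using part that finite_subset[OF _ finW] unfolding open_cone_partition_def by auto
  have S2: "disjoint_family_on open_cone \<S>" and S3: "?K = (\<Union>S\<in>\<S>. open_cone S)"
    using part unfolding open_cone_partition_def by auto
  define \<R> where "\<R> = {S\<in>\<S>. open_cone S \<subseteq> R}"
  have finR: "finite \<R>"
    by (rule finite_subset[of _ "Pow ?W"]) (use S1(1) finW in \<open>auto simp: \<R>_def\<close>)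
  \<comment> \<open>\<open>R\<close> absorbs the whole cone under addition; by
    \<open>open_cone_uniform\<close> a piece that meets \<open>R\<close> therefore lies in
    \<open>R\<close>.\<close>
  have Radd: "m *\<^sub>R y + v \<in> R" if yR: "y \<in> R" and vK: "v \<in> ?K" and m: "m > 0" for y v m
  proof -
    obtain s x where y: "y = (s, s *\<^sub>R x)" "0 < s" "x \<in> rel_interior Q" using yR by (auto simp: R_def)
    obtain s' x' where v: "v = (s', s' *\<^sub>R x')" "0 \<le> s'" "x' \<in> Q" using vK unfolding K by auto
    obtain z where "z \<in> rel_interior Q" "(m * s) *\<^sub>R x + s' *\<^sub>R x' = (m * s + s') *\<^sub>R z"
      using rel_interior_add_cone[of Q "m * s" x s' x'] y v m by (auto simp: Q_def)
    then show ?thesis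
      unfolding R_def using y v m by (intro CollectI exI[of _ "m * s + s'"] exI[of _ z]) (auto intro: add_pos_nonneg)
  qed
  have RU: "R = (\<Union>S\<in>\<R>. open_cone S)"
  proof (intro set_eqI iffI)
    fix y assume y: "y \<in> R"
    then have "y \<in> ?K" unfolding K R_def using rel_interior_subset[of Q] by force
    then obtain S where S: "S \<in> \<S>" "y \<in> open_cone S" using S3 by blast
    have "open_cone S \<subseteq> ?K" using S3 S(1) by blast
    then have "z \<in> R" if "z \<in> open_cone S" for z
      using open_cone_uniform[OF S1(3)[OF S(1)] S(2) that, of "\<lambda>y. y \<in> R"] y Radd by blast
    with S show "y \<in> (\<Union>S\<in>\<R>. open_cone S)" by (auto simp: \<R>_def)
  qed (auto simp: \<R>_def)
  have "quasi_poly_on (Suc (poly_dim Q)) {0<..} (\<lambda>s. \<Sum>S\<in>\<R>. real (card (slice (open_cone S) s)))"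
  proof (rule quasi_poly_on_sum)
    fix S assume "S \<in> \<R>"
    then have S: "S \<in> \<S>" by (simp add: \<R>_def)
    have "quasi_poly_on (card S) (if ({} :: (real \<times> (real ^ 'n)) set) = {} then {0<..} else {0..})
      (\<lambda>s. real (card (slice (comb_set S (\<lambda>w. if w \<in> {} then {0..} else {0<..})) s)))"
      by (rule quasi_poly_on_card_slice) (use S1[OF S] W1 in auto)
    then show "quasi_poly_on (Suc (poly_dim Q)) {0<..} (\<lambda>s. real (card (slice (open_cone S) s)))"
      by (rule quasi_poly_on_mono) (use bound[OF S1(1,2)[OF S]] in auto)
  qed
  then show "quasi_poly_on (Suc (poly_dim Q)) {0<..} (\<lambda>s. real (lattice_count (rel_interior Q) s))"
  proof (rule quasi_poly_on_mono)
    fix s :: real assume "s \<in> {0<..}"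
    then have "dilate s (rel_interior Q) \<inter> int_lattice = slice R s"
      unfolding R_def by (auto simp: slice_def dilate_def)
    also have "card \<dots> = (\<Sum>S\<in>\<R>. card (slice (open_cone S) s))"
      unfolding RU using finR
    proof (intro card_slice_UN)
      show "disjoint_family_on open_cone \<R>"
        using S2 by (auto simp: disjoint_family_on_def \<R>_def)
      fix S assume "S \<in> \<R>"
      then have S: "S \<in> \<S>" by (simp add: \<R>_def)
      show "finite (slice (open_cone S) s)"
        by (rule finite_slice_comb_set) (use S1[OF S] W1 in auto)
    qed
    finally show "s \<in> {0<..} \<and> real (lattice_count (rel_interior Q) s) = (\<Sum>S\<in>\<R>. real (card (slice (open_cone S) s)))"
      using \<open>s \<in> {0<..}\<close> by (simp add: lattice_count_def)
  qed simp
qed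

section \<open>Rescaling from period 1 to period d and extending to the real line\<close>

lemma quasi_poly_on_expansion:
  assumes "quasi_poly_on (Suc m) D G" "d > 0" "\<And>t. t \<in> D' \<Longrightarrow> t / d \<in> D \<and> L t = G (t / d)"
  shows "\<exists>c. (\<forall>k t. c k (t + d) = c k t) \<and> (\<forall>t\<in>D'. complex_of_real (L t) = expansion m c t)"
proof -
  from assms(1) obtain p :: "real \<Rightarrow> real poly" where p: "\<And>s. p (s + 1) = p s"
    "\<And>s i. i \<ge> Suc m \<Longrightarrow> coeff (p s) i = 0" "\<And>s. s \<in> D \<Longrightarrow> G s = poly (p s) s"
    unfolding quasi_poly_on_def by blast
  \<comment> \<open>Substituting s = t / d turns period 1 in \<open>s\<close> into period
    \<open>d\<close> in \<open>t\<close>; the divisor \<open>d ^ k\<close> comes from (t /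
    d)^k.\<close>
  define c where "c k t = complex_of_real (coeff (p (t / d)) k / d ^ k)" for k t
  have "c k (t + d) = c k t" for k t
    using assms(2) by (simp add: c_def add_divide_distrib p(1))
  moreover have "complex_of_real (L t) = expansion m c t" if "t \<in> D'" for t
  proof -
    have deg: "degree (p (t / d)) \<le> m" using p(2) by (intro degree_le) auto
    have "L t = poly (p (t / d)) (t / d)" using assms(3)[OF that] p(3) by simp
    also have "\<dots> = (\<Sum>k\<le>m. coeff (p (t / d)) k * (t / d) ^ k)"
      unfolding poly_altdef using deg p(2)
      by (intro sum.mono_neutral_left) (auto simp: coeff_eq_0)
    finally show ?thesis
      by (simp add: expansion_def c_def power_divide)
  qed
  ultimately show ?thesis by blast
qed

text \<open>A function of period \<open>d\<close> on the whole line already takes the prescribed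
  values, so it is its own extension.\<close>

lemma extends_from_periodic:
  assumes "\<And>t. c (t + d) = c t"
  shows "extends_from S d c c"
proof -
  have nat: "c (t + real n * d) = c t" for t n
  proof (induction n)
    case (Suc n)
    then show ?case using assms[of "t + real n * d"] by (simp add: algebra_simps)
  qed simp
  have "c (t + of_int m * d) = c t" for t and m :: int
  proof (cases m)
    case (nonneg n)
    then show ?thesis using nat[of t n] by simp
  next
    case (neg n)
    then have "real_of_int m = - real (Suc n)" by (simp only: of_int_minus of_int_of_nat_eq)
    then have "of_int m * d = - (real (Suc n) * d)" by (simp only: mult_minus_left)
    then have "t + of_int m * d + real (Suc n) * d = t" by linarith
    then show ?thesis using nat[of "t + of_int m * d" "Suc n"] by (simp only:)
  qed
  then show ?thesis by (simp add: extends_from_def)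
qed

theorem theorem1p3:
  fixes P :: "(real ^ 'n) set" and d :: real
  assumes "rational_polytope P" and "is_denominator P d"
  shows "\<exists>(c :: nat \<Rightarrow> real \<Rightarrow> complex) (c_int :: nat \<Rightarrow> real \<Rightarrow> complex).
      (\<forall>t\<ge>0. of_nat (lattice_count P t) = expansion (poly_dim P) c t) \<and>
      (\<forall>t>0. of_nat (lattice_count (rel_interior P) t) = expansion (poly_dim P) c_int t) \<and>
      (\<forall>k\<le>poly_dim P. \<forall>t\<ge>0. c k (t + d) = c k t) \<and>
      (\<forall>k\<le>poly_dim P. \<forall>t>0. c_int k (t + d) = c_int k t) \<and>
      (\<exists>e e_int.
        (\<forall>k\<le>poly_dim P. extends_from {0..} d (c k) (e k)) \<and>
        (\<forall>k\<le>poly_dim P. extends_from {0<..} d (c_int k) (e_int k)) \<and>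
        (\<forall>k\<le>poly_dim P. \<forall>t. e k (t + d) = e k t) \<and>
        (\<forall>k\<le>poly_dim P. \<forall>t. e_int k (t + d) = e_int k t) \<and>
        real_quasi_polynomial (poly_dim P) (expansion (poly_dim P) e) \<and>
        real_quasi_polynomial (poly_dim P) (expansion (poly_dim P) e_int))"
proof -
  define Q where "Q = dilate d P"
  have d: "d > 0" and Q: "integral_polytope Q" and least: "\<forall>s>0. integral_polytope (dilate s P) \<longrightarrow> d \<le> s"
    using assms(2) by (auto simp: is_denominator_def Q_def)
  \<comment> \<open>All dilates of the empty set coincide, so \<open>d / 2\<close> would contradict
    the minimality of \<open>d\<close>.\<close>
  have "P \<noteq> {}"
  proof
    assume "P = {}"
    then have "integral_polytope (dilate (d / 2) P)" using Q by (simp add: Q_def dilate_def)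
    moreover have "d / 2 > 0" using d by simp
    ultimately have "d \<le> d / 2" using least by blast
    with d show False by simp
  qed
  define V where "V = {v. v extreme_point_of Q}"
  have QV: "Q = convex hull V"
    using Q unfolding V_def integral_polytope_def
    by (intro Krein_Milman_Minkowski) (auto simp: polytope_imp_compact polytope_imp_convex)
  have "finite V"
    using Q unfolding V_def integral_polytope_def by (intro finite_polyhedron_extreme_points) (auto simp: polytope_imp_polyhedron)
  moreover have "V \<noteq> {}" using \<open>P \<noteq> {}\<close> QV by (auto simp: Q_def dilate_def)
  moreover have "V \<subseteq> int_lattice" using Q by (auto simp: V_def integral_polytope_def)
  ultimately have qp: "quasi_poly_on (Suc (poly_dim Q)) {0..} (\<lambda>s. real (lattice_count Q s))"
    "quasi_poly_on (Suc (poly_dim Q)) {0<..} (\<lambda>s. real (lattice_count (rel_interior Q) s))"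
    unfolding QV by (rule quasi_poly_on_lattice_count)+
  \<comment> \<open>Counting for \<open>P\<close> at \<open>t\<close> thus becomes counting for
    \<open>Q\<close> at \<open>t / d\<close>.\<close>
  have dil: "dilate (t / d) (dilate d X) = dilate t X" for t and X :: "(real ^ 'n) set"
    using d by (simp add: dilate_def image_image)
  have dim: "poly_dim Q = poly_dim P"
    unfolding poly_dim_def Q_def dilate_def using d
    by (subst aff_dim_injective_linear_image) (auto simp: inj_on_def linear_scaleR)
  have ri: "rel_interior Q = dilate d (rel_interior P)"
    unfolding Q_def dilate_def using d rel_interior_scaleR[of d P] by simp
  obtain c where c: "\<And>k t. c k (t + d) = c k t"
    "\<And>t. t \<ge> 0 \<Longrightarrow> of_nat (lattice_count P t) = expansion (poly_dim P) c t"
    using quasi_poly_on_expansion[OF qp(1) d, of "{0..}" "\<lambda>t. real (lattice_count P t)"] d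
    unfolding dim by (auto simp: lattice_count_def Q_def dil)
  obtain c_int where c_int: "\<And>k t. c_int k (t + d) = c_int k t"
    "\<And>t. t > 0 \<Longrightarrow> of_nat (lattice_count (rel_interior P) t) = expansion (poly_dim P) c_int t"
    using quasi_poly_on_expansion[OF qp(2) d, of "{0<..}" "\<lambda>t. real (lattice_count (rel_interior P) t)"] d
    unfolding dim by (auto simp: lattice_count_def ri dil)
  have rq: "real_quasi_polynomial m (expansion m b)" if "\<And>k t. b k (t + d) = b k t" for m b
  proof -
    have "periodic (b k)" for k
      unfolding periodic_def using that d by (intro exI[of _ d]) simp
    then show ?thesis
      unfolding real_quasi_polynomial_def by (intro exI[of _ b]) simp
  qed
  show ?thesis
    \<comment> \<open>The coefficients obtained are periodic on the whole line and serve as their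
      own extensions \<open>e\<close> and \<open>e_int\<close>.\<close>
    by (rule exI[of _ c], rule exI[of _ c_int], intro conjI exI[of _ c] exI[of _ c_int])
      (simp_all add: c c_int extends_from_periodic rq)
qed

end
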